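(* Let $p:\mathcal D\to\mathcal C$ be a functor and suppose that $\mathcal C$ is factorization preordered. If $\mathcal D$ is relatively locally finite (relative to $p$) and $\mathcal C$ has locally finite slices and coslices, then $\mathrm{Bif}(p)$ is relatively locally finite (relative to $\Lambda_p$). In particular, for every object $A\in\mathcal C$ the fiber category $\mathrm{Bif}(p)_A$ is locally finite.
   Context: Composition is in diagrammatic order. $\mathcal C$ is factorization preordered if for all composable $f$, $g,h$ (parallel), $k$: $fg=fh$ and $gk=hk$ imply $g=h$. A category is locally finite if all its homsets are finite; $\mathcal C$ has locally finite slices and coslices if all $\mathcal C/A$ and $A/\mathcal C$ are locally finite. A category $\mathcal E$ with a functor $q:\mathcal E\to\mathcal C$ is relatively locally finite (relative to $q$) if for every $f:A\to B$ in $\mathcal C$ and $X,Y\in\mathcal E$ over $A,B$, the set of arrows $\delta:X\to Y$ with $q(\delta)=f$ is finite. The fiber category $\mathcal E_A$ consists of the objects over $A$ and arrows over $\mathrm{id}_A$. A (cloven) bifibration is a functor $q:\mathcal E\to\mathcal C$ with, for every $f:A\to B$ in $\mathcal C$ and $S$ over $A$, a chosen $f_S:S\to f^+S$ over $f$ such that each $\alpha:S\to T$ over $fg$ factors uniquely as $\alpha=f_S\beta$ with $\beta$ over $g$; and for every $g:B\to C$ and $T$ over $C$, a chosen $\bar g_T:g^-T\to T$ over $g$ such that each $\alpha:S\to T$ over $fg$ factors uniquely as $\alpha=\beta\bar g_T$ with $\beta$ over $f$. Morphisms of bifibrations over $\mathcal C$ are functors over $\mathcal C$ sending chosen liftings to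 chosen liftings. The free bifibration on $p$ is a bifibration $\Lambda_p:\mathrm{Bif}(p)\to\mathcal C$ with a functor $\eta_p:\mathcal D\to\mathrm{Bif}(p)$, $\Lambda_p\eta_p=p$, such that for every bifibration $q:\mathcal E\to\mathcal C$ and $\theta:\mathcal D\to\mathcal E$ with $q\theta=p$ there is a unique morphism of bifibrations $F$ with $F\eta_p=\theta$. *)

theory Defs
  imports Main "HOL-Library.Infinite_Typeclass"
begin

text \<open>
  Categories, with composition in diagrammatic order: \<open>f \<cdot>\<^bsub>C\<^esub> g\<close> is first \<open>f\<close>, then \<open>g\<close>.
  The fields are meaningful only on the carriers \<open>Ob C\<close> and \<open>Ar C\<close>, and composition only
  on composable arrows.
\<close>

record ('o, 'a) category =
  Ob :: "'o set"
  Ar :: "'a set"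
  src :: "'a \<Rightarrow> 'o"
  tgt :: "'a \<Rightarrow> 'o"
  ide :: "'o \<Rightarrow> 'a"
  cmp :: "'a \<Rightarrow> 'a \<Rightarrow> 'a"  (infixl \<open>\<cdot>\<index>\<close> 70)

locale category =
  fixes C :: "('o, 'a) category" (structure)
  assumes src_in_Ob: "f \<in> Ar C \<Longrightarrow> src C f \<in> Ob C"
    and tgt_in_Ob: "f \<in> Ar C \<Longrightarrow> tgt C f \<in> Ob C"
    and ide_in_Ar: "A \<in> Ob C \<Longrightarrow> ide C A \<in> Ar C"
    and src_ide: "A \<in> Ob C \<Longrightarrow> src C (ide C A) = A"
    and tgt_ide: "A \<in> Ob C \<Longrightarrow> tgt C (ide C A) = A"
    and cmp_in_Ar: "\<lbrakk>f \<in> Ar C; g \<in> Ar C; tgt C f = src C g\<rbrakk> \<Longrightarrow> f \<cdot> g \<in> Ar C"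
    and src_cmp: "\<lbrakk>f \<in> Ar C; g \<in> Ar C; tgt C f = src C g\<rbrakk> \<Longrightarrow> src C (f \<cdot> g) = src C f"
    and tgt_cmp: "\<lbrakk>f \<in> Ar C; g \<in> Ar C; tgt C f = src C g\<rbrakk> \<Longrightarrow> tgt C (f \<cdot> g) = tgt C g"
    and ide_cmp: "f \<in> Ar C \<Longrightarrow> ide C (src C f) \<cdot> f = f"
    and cmp_ide: "f \<in> Ar C \<Longrightarrow> f \<cdot> ide C (tgt C f) = f"
    and cmp_assoc: "\<lbrakk>f \<in> Ar C; g \<in> Ar C; h \<in> Ar C; tgt C f = src C g; tgt C g = src C h\<rbrakk>
      \<Longrightarrow> (f \<cdot> g) \<cdot> h = f \<cdot> (g \<cdot> h)"

definition homset :: "('o, 'a) category \<Rightarrow> 'o \<Rightarrow> 'o \<Rightarrow> 'a set" where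
  "homset C A B = {f \<in> Ar C. src C f = A \<and> tgt C f = B}"

definition locally_finite :: "('o, 'a) category \<Rightarrow> bool" where
  "locally_finite C \<longleftrightarrow> (\<forall>A\<in>Ob C. \<forall>B\<in>Ob C. finite (homset C A B))"

definition factorization_preordered :: "('o, 'a) category \<Rightarrow> bool" where
  "factorization_preordered C \<longleftrightarrow>
    (\<forall>f\<in>Ar C. \<forall>g\<in>Ar C. \<forall>h\<in>Ar C. \<forall>k\<in>Ar C.
      src C g = src C h \<longrightarrow> tgt C g = tgt C h \<longrightarrow>
      tgt C f = src C g \<longrightarrow> tgt C g = src C k \<longrightarrow>
      f \<cdot>\<^bsub>C\<^esub> g = f \<cdot>\<^bsub>C\<^esub> h \<longrightarrow> g \<cdot>\<^bsub>C\<^esub> k = h \<cdot>\<^bsub>C\<^esub> k \<longrightarrow> g = h)"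

text \<open>
  An arrow of a (co)slice is a triple \<open>(f, h, g)\<close>, where \<open>h\<close> is the underlying arrow
  of \<open>C\<close> and \<open>f\<close>, \<open>g\<close> are its source and target.
\<close>

definition slice :: "('o, 'a) category \<Rightarrow> 'o \<Rightarrow> ('a, 'a \<times> 'a \<times> 'a) category" where
  "slice C A =
    \<lparr> Ob = {f \<in> Ar C. tgt C f = A},
      Ar = {(f, h, g). f \<in> Ar C \<and> tgt C f = A \<and> g \<in> Ar C \<and> tgt C g = A \<and>
              h \<in> homset C (src C f) (src C g) \<and> h \<cdot>\<^bsub>C\<^esub> g = f},
      src = (\<lambda>(f, h, g). f),
      tgt = (\<lambda>(f, h, g). g),
      ide = (\<lambda>f. (f, ide C (src C f), f)),
      cmp = (\<lambda>(f, h, g) (f', h', g'). (f, h \<cdot>\<^bsub>C\<^esub> h', g')) \<rparr>"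

definition coslice :: "('o, 'a) category \<Rightarrow> 'o \<Rightarrow> ('a, 'a \<times> 'a \<times> 'a) category" where
  "coslice C A =
    \<lparr> Ob = {f \<in> Ar C. src C f = A},
      Ar = {(f, h, g). f \<in> Ar C \<and> src C f = A \<and> g \<in> Ar C \<and> src C g = A \<and>
              h \<in> homset C (tgt C f) (tgt C g) \<and> f \<cdot>\<^bsub>C\<^esub> h = g},
      src = (\<lambda>(f, h, g). f),
      tgt = (\<lambda>(f, h, g). g),
      ide = (\<lambda>f. (f, ide C (tgt C f), f)),
      cmp = (\<lambda>(f, h, g) (f', h', g'). (f, h \<cdot>\<^bsub>C\<^esub> h', g')) \<rparr>"

definition locally_finite_slices :: "('o, 'a) category \<Rightarrow> bool" where
  "locally_finite_slices C \<longleftrightarrow> (\<forall>A\<in>Ob C. locally_finite (slice C A))"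

definition locally_finite_coslices :: "('o, 'a) category \<Rightarrow> bool" where
  "locally_finite_coslices C \<longleftrightarrow> (\<forall>A\<in>Ob C. locally_finite (coslice C A))"

lemma (in category) category_slice: "category (slice C A)"
proof (unfold_locales, goal_cases)
  case (3 f)
  then show ?case
    by (simp add: slice_def homset_def src_in_Ob tgt_in_Ob ide_in_Ar src_ide tgt_ide ide_cmp)
next
  case (6 x y)
  then show ?case
    by (cases x; cases y) (simp add: slice_def homset_def cmp_in_Ar src_cmp tgt_cmp cmp_assoc)
next
  case (9 x)
  then show ?case
    by (cases x) (simp add: slice_def homset_def, metis ide_cmp)
next
  case (10 x)
  then show ?case
    by (cases x) (simp add: slice_def homset_def, metis cmp_ide)
next
  case (11 x y z)
  then show ?case
    by (cases x; cases y; cases z) (simp add: slice_def homset_def cmp_assoc)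
qed (auto simp: slice_def)

lemma (in category) category_coslice: "category (coslice C A)"
proof (unfold_locales, goal_cases)
  case (3 f)
  then show ?case
    by (simp add: coslice_def homset_def src_in_Ob tgt_in_Ob ide_in_Ar src_ide tgt_ide cmp_ide)
next
  case (6 x y)
  then show ?case
    by (cases x; cases y) (simp add: coslice_def homset_def cmp_in_Ar src_cmp tgt_cmp cmp_assoc[symmetric])
next
  case (9 x)
  then show ?case
    by (cases x) (simp add: coslice_def homset_def, metis ide_cmp)
next
  case (10 x)
  then show ?case
    by (cases x) (simp add: coslice_def homset_def, metis cmp_ide)
next
  case (11 x y z)
  then show ?case
    by (cases x; cases y; cases z) (simp add: coslice_def homset_def cmp_assoc)
qed (auto simp: coslice_def)

record ('o, 'a, 'p, 'b) cat_map =
  on_ob :: "'o \<Rightarrow> 'p"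
  on_ar :: "'a \<Rightarrow> 'b"

locale is_functor = D: category D + C: category C
  for D :: "('o, 'a) category" and C :: "('p, 'b) category"
    and F :: "('o, 'a, 'p, 'b) cat_map" +
  assumes on_ob_in: "X \<in> Ob D \<Longrightarrow> on_ob F X \<in> Ob C"
    and on_ar_in: "f \<in> Ar D \<Longrightarrow> on_ar F f \<in> Ar C"
    and src_on_ar: "f \<in> Ar D \<Longrightarrow> src C (on_ar F f) = on_ob F (src D f)"
    and tgt_on_ar: "f \<in> Ar D \<Longrightarrow> tgt C (on_ar F f) = on_ob F (tgt D f)"
    and on_ar_ide: "X \<in> Ob D \<Longrightarrow> on_ar F (ide D X) = ide C (on_ob F X)"
    and on_ar_cmp: "\<lbrakk>f \<in> Ar D; g \<in> Ar D; tgt D f = src D g\<rbrakk>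
      \<Longrightarrow> on_ar F (f \<cdot>\<^bsub>D\<^esub> g) = on_ar F f \<cdot>\<^bsub>C\<^esub> on_ar F g"

text \<open>
  Composition of functors is written in the usual applicative order, as in \<open>q \<theta> = p\<close>.
\<close>

definition functor_comp ::
    "('p, 'b, 'q, 'c) cat_map \<Rightarrow> ('o, 'a, 'p, 'b) cat_map \<Rightarrow> ('o, 'a, 'q, 'c) cat_map"
    (infixl \<open>\<circ>\<^sub>F\<close> 55) where
  "G \<circ>\<^sub>F F = \<lparr> on_ob = on_ob G \<circ> on_ob F, on_ar = on_ar G \<circ> on_ar F \<rparr>"

text \<open>
  Equality of functors out of \<open>D\<close>; HOL equality of the underlying total functions would also
  compare their irrelevant values outside the carriers of \<open>D\<close>.
\<close>

definition functor_eq ::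
    "('o, 'a) category \<Rightarrow> ('o, 'a, 'p, 'b) cat_map \<Rightarrow> ('o, 'a, 'p, 'b) cat_map \<Rightarrow> bool" where
  "functor_eq D F G \<longleftrightarrow>
    (\<forall>X\<in>Ob D. on_ob F X = on_ob G X) \<and> (\<forall>f\<in>Ar D. on_ar F f = on_ar G f)"

definition relatively_locally_finite ::
    "('p, 'b) category \<Rightarrow> ('o, 'a) category \<Rightarrow> ('o, 'a, 'p, 'b) cat_map \<Rightarrow> bool" where
  "relatively_locally_finite C E q \<longleftrightarrow>
    (\<forall>f\<in>Ar C. \<forall>X\<in>Ob E. \<forall>Y\<in>Ob E. on_ob q X = src C f \<longrightarrow> on_ob q Y = tgt C f \<longrightarrow>
      finite {\<delta> \<in> homset E X Y. on_ar q \<delta> = f})"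

definition fiber ::
    "('p, 'b) category \<Rightarrow> ('o, 'a) category \<Rightarrow> ('o, 'a, 'p, 'b) cat_map \<Rightarrow> 'p \<Rightarrow> ('o, 'a) category"
  where
  "fiber C E q A =
    E\<lparr> Ob := {X \<in> Ob E. on_ob q X = A}, Ar := {\<delta> \<in> Ar E. on_ar q \<delta> = ide C A} \<rparr>"

lemma category_fiber:
  assumes "is_functor E C q" and "A \<in> Ob C"
  shows "category (fiber C E q A)"
proof -
  interpret is_functor E C q by fact
  have s: "on_ob q (src E f) = A" if "f \<in> Ar E" "on_ar q f = ide C A" for f
    using src_on_ar[OF that(1)] that(2) C.src_ide[OF assms(2)] by simp
  have t: "on_ob q (tgt E f) = A" if "f \<in> Ar E" "on_ar q f = ide C A" for f
    using tgt_on_ar[OF that(1)] that(2) C.tgt_ide[OF assms(2)] by simp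
  have i: "ide C A \<cdot>\<^bsub>C\<^esub> ide C A = ide C A"
    using C.ide_cmp[OF C.ide_in_Ar[OF assms(2)]] C.src_ide[OF assms(2)] by simp
  show ?thesis
    by unfold_locales
      (auto simp: fiber_def s t i D.src_in_Ob D.tgt_in_Ob D.ide_in_Ar D.src_ide D.tgt_ide
        D.cmp_in_Ar D.src_cmp D.tgt_cmp D.ide_cmp D.cmp_ide D.cmp_assoc on_ar_ide on_ar_cmp)
qed

text \<open>
  The data of a cloven bifibration over a category with objects in \<open>'p\<close> and arrows in \<open>'b\<close>.
  \<open>push E f S\<close> is the chosen lifting \<open>f\<^sub>S : S \<rightarrow> f\<^sup>+S\<close>, for \<open>S\<close> over the source of \<open>f\<close>, and
  \<open>pull E g T\<close> is the chosen lifting \<open>g\<^sup>-T \<rightarrow> T\<close>, for \<open>T\<close> over the target of \<open>g\<close>. The objects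
  \<open>f\<^sup>+S\<close> and \<open>g\<^sup>-T\<close> are recovered as the target, respectively the source, of these arrows.
\<close>

record ('o, 'a, 'p, 'b) bifib =
  total :: "('o, 'a) category"
  proj :: "('o, 'a, 'p, 'b) cat_map"
  push :: "'b \<Rightarrow> 'o \<Rightarrow> 'a"
  pull :: "'b \<Rightarrow> 'o \<Rightarrow> 'a"

locale bifibration = is_functor "total E" C "proj E"
  for C :: "('p, 'b) category" and E :: "('o, 'a, 'p, 'b) bifib" +
  assumes push_lift: "\<lbrakk>f \<in> Ar C; S \<in> Ob (total E); on_ob (proj E) S = src C f\<rbrakk> \<Longrightarrow>
      push E f S \<in> Ar (total E) \<and> src (total E) (push E f S) = S \<and> on_ar (proj E) (push E f S) = f"
    and push_factor: "\<lbrakk>f \<in> Ar C; S \<in> Ob (total E); on_ob (proj E) S = src C f;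
      g \<in> Ar C; tgt C f = src C g;
      \<alpha> \<in> Ar (total E); src (total E) \<alpha> = S; on_ar (proj E) \<alpha> = f \<cdot>\<^bsub>C\<^esub> g\<rbrakk> \<Longrightarrow>
      \<exists>!\<beta>. \<beta> \<in> homset (total E) (tgt (total E) (push E f S)) (tgt (total E) \<alpha>) \<and>
        on_ar (proj E) \<beta> = g \<and> \<alpha> = push E f S \<cdot>\<^bsub>total E\<^esub> \<beta>"
    and pull_lift: "\<lbrakk>g \<in> Ar C; T \<in> Ob (total E); on_ob (proj E) T = tgt C g\<rbrakk> \<Longrightarrow>
      pull E g T \<in> Ar (total E) \<and> tgt (total E) (pull E g T) = T \<and> on_ar (proj E) (pull E g T) = g"
    and pull_factor: "\<lbrakk>g \<in> Ar C; T \<in> Ob (total E); on_ob (proj E) T = tgt C g;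
      f \<in> Ar C; tgt C f = src C g;
      \<alpha> \<in> Ar (total E); tgt (total E) \<alpha> = T; on_ar (proj E) \<alpha> = f \<cdot>\<^bsub>C\<^esub> g\<rbrakk> \<Longrightarrow>
      \<exists>!\<beta>. \<beta> \<in> homset (total E) (src (total E) \<alpha>) (src (total E) (pull E g T)) \<and>
        on_ar (proj E) \<beta> = f \<and> \<alpha> = \<beta> \<cdot>\<^bsub>total E\<^esub> pull E g T"

locale bifibration_morphism =
  E: bifibration C E + E': bifibration C E' + is_functor "total E" "total E'" F
  for C :: "('p, 'b) category" and E :: "('o, 'a, 'p, 'b) bifib"
    and E' :: "('o', 'a', 'p, 'b) bifib" and F :: "('o, 'a, 'o', 'a') cat_map" +
  assumes over: "functor_eq (total E) (proj E' \<circ>\<^sub>F F) (proj E)"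
    and on_ar_push: "\<lbrakk>f \<in> Ar C; S \<in> Ob (total E); on_ob (proj E) S = src C f\<rbrakk> \<Longrightarrow>
      on_ar F (push E f S) = push E' f (on_ob F S)"
    and on_ar_pull: "\<lbrakk>g \<in> Ar C; T \<in> Ob (total E); on_ob (proj E) T = tgt C g\<rbrakk> \<Longrightarrow>
      on_ar F (pull E g T) = pull E' g (on_ob F T)"

text \<open>
  \<open>free_bifibration D C p B \<eta>\<close>: the bifibration \<open>B\<close> over \<open>C\<close> together with the functor \<open>\<eta>\<close> is
  a free bifibration on \<open>p\<close>. HOL cannot quantify over types inside a formula, so all small
  categories involved have their objects and arrows in one infinite type \<open>'u\<close>, which plays the
  role of the universe. Being infinite, \<open>'u\<close> also has room for the free bifibration on
  any functor between categories in \<open>'u\<close>: its objects and arrows are classes of finite terms in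
  the objects and arrows of \<open>C\<close> and \<open>D\<close>. Hence freeness tested in \<open>'u\<close> is the same as freeness
  tested in any larger universe. This would fail if \<open>B\<close> were allowed to lie in a larger type
  than the test bifibrations.
\<close>

locale free_bifibration =
  p: is_functor D C p + B: bifibration C B + \<eta>: is_functor D "total B" \<eta>
  for D C :: "('u::infinite, 'u) category" and p :: "('u, 'u, 'u, 'u) cat_map"
    and B :: "('u, 'u, 'u, 'u) bifib" and \<eta> :: "('u, 'u, 'u, 'u) cat_map" +
  assumes proj_unit: "functor_eq D (proj B \<circ>\<^sub>F \<eta>) p"
    and universal_ex: "\<And>(E :: ('u, 'u, 'u, 'u) bifib) \<theta>.
      \<lbrakk>bifibration C E; is_functor D (total E) \<theta>; functor_eq D (proj E \<circ>\<^sub>F \<theta>) p\<rbrakk> \<Longrightarrow>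
      \<exists>F. bifibration_morphism C B E F \<and> functor_eq D (F \<circ>\<^sub>F \<eta>) \<theta>"
    and universal_uniq: "\<And>(E :: ('u, 'u, 'u, 'u) bifib) \<theta> F G.
      \<lbrakk>bifibration C E; is_functor D (total E) \<theta>; functor_eq D (proj E \<circ>\<^sub>F \<theta>) p;
        bifibration_morphism C B E F; functor_eq D (F \<circ>\<^sub>F \<eta>) \<theta>;
        bifibration_morphism C B E G; functor_eq D (G \<circ>\<^sub>F \<eta>) \<theta>\<rbrakk> \<Longrightarrow>
      functor_eq (total B) F G"

end

theory Submission
  imports Defs
begin

text \<open>
  Formulas name objects of a bifibration \<open>B\<close> over \<open>C\<close> with a functor from \<open>D\<close>: there is an atom
  for each object of \<open>D\<close>, and there are the two connectives \<open>f\<^sup>+\<close> and \<open>g\<^sup>-\<close>. A cut-free sequent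
  calculus derives arrows of \<open>B\<close> between formulas. Its axioms are the images of the arrows of \<open>D\<close>,
  and each connective has a left and a right rule, one of which composes with a chosen lifting
  while the other factors through it. Identities are derivable (\<open>der_ide\<close>)
  and so are composites (\<open>der_cut\<close>, cut elimination by induction on the sizes of the three formulas).
  Hence formulas and derivable arrows form a bifibration \<open>der_bifib\<close>, with a forgetful morphism to
  \<open>B\<close> and a functor from \<open>D\<close>.

  If \<open>B\<close> is free, universality gives a morphism \<open>F\<close> from \<open>B\<close> to \<open>der_bifib\<close>, and \<open>F\<close> followed by the
  forgetful morphism is the identity. So every arrow \<open>\<alpha> : S \<rightarrow> T\<close> of \<open>B\<close> is derivable between the two
  formulas \<open>F S\<close> and \<open>F T\<close>, which depend on \<open>S\<close> and \<open>T\<close> only (\<open>ex_derivation\<close>).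

  It remains to see that only finitely many arrows over a given \<open>h\<close> are derivable between two given
  formulas (\<open>finite_der\<close>). Read from conclusion to premise, each rule removes one connective, so
  proof search terminates; and it branches finitely. A rule that
  factors through a chosen lifting leaves no choice, since its premise determines its conclusion;
  between two atoms there are only finitely many axioms over \<open>h\<close>, as \<open>D\<close> is relatively locally
  finite; the premise of the right rule for \<open>f\<^sup>+\<close> lies over some \<open>k\<close> with \<open>k \<cdot> f = h\<close>, an arrow of a slice; and
  the premise of the left rule for \<open>g\<^sup>-\<close> lies over some \<open>k\<close> with \<open>g \<cdot> k = h\<close>, an arrow of a coslice.
\<close>

section \<open>Finiteness in slices and coslices\<close>

lemma finite_left_factors:
  assumes "category C" and "locally_finite_slices C"
    and f: "f \<in> Ar C" and h: "h \<in> Ar C" and t: "tgt C f = tgt C h"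
  shows "finite {g \<in> homset C (src C h) (src C f). g \<cdot>\<^bsub>C\<^esub> f = h}"
proof -
  interpret category C by fact
  have "finite (homset (slice C (tgt C h)) h f)"
    using assms(2) f h t tgt_in_Ob[OF h]
    by (simp add: locally_finite_slices_def locally_finite_def slice_def)
  moreover have "{g \<in> homset C (src C h) (src C f). g \<cdot>\<^bsub>C\<^esub> f = h}
      \<subseteq> (\<lambda>(_, g, _). g) ` homset (slice C (tgt C h)) h f"
    using f h t by (force simp: homset_def slice_def image_iff)
  ultimately show ?thesis
    by (meson finite_imageI finite_subset)
qed

lemma finite_right_factors:
  assumes "category C" and "locally_finite_coslices C"
    and f: "f \<in> Ar C" and h: "h \<in> Ar C" and s: "src C f = src C h"
  shows "finite {g \<in> homset C (tgt C f) (tgt C h). f \<cdot>\<^bsub>C\<^esub> g = h}"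
proof -
  interpret category C by fact
  have "finite (homset (coslice C (src C h)) f h)"
    using assms(2) f h s src_in_Ob[OF h]
    by (simp add: locally_finite_coslices_def locally_finite_def coslice_def)
  moreover have "{g \<in> homset C (tgt C f) (tgt C h). f \<cdot>\<^bsub>C\<^esub> g = h}
      \<subseteq> (\<lambda>(_, g, _). g) ` homset (coslice C (src C h)) f h"
    using f h s by (force simp: homset_def coslice_def image_iff)
  ultimately show ?thesis
    by (meson finite_imageI finite_subset)
qed

section \<open>Morphisms of bifibrations\<close>

lemma bifibration_morphism_id:
  assumes "bifibration C E"
  shows "bifibration_morphism C E E \<lparr>on_ob = id, on_ar = id\<rparr>"
proof -
  interpret bifibration C E by fact
  show ?thesis
    by unfold_locales (auto simp: functor_eq_def functor_comp_def)
qed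

lemma bifibration_morphism_comp:
  assumes "bifibration_morphism C E E' F" and "bifibration_morphism C E' E'' G"
  shows "bifibration_morphism C E E'' (G \<circ>\<^sub>F F)"
proof -
  interpret F: bifibration_morphism C E E' F by fact
  interpret G: bifibration_morphism C E' E'' G by fact
  have ob: "on_ob (proj E') (on_ob F S) = on_ob (proj E) S" if "S \<in> Ob (total E)" for S
    using F.over that by (simp add: functor_eq_def functor_comp_def)
  show ?thesis
    using F.over G.over
    by unfold_locales
      (auto simp: functor_eq_def functor_comp_def ob F.on_ob_in F.on_ar_in F.src_on_ar F.tgt_on_ar
        F.on_ar_ide F.on_ar_cmp F.on_ar_push F.on_ar_pull G.on_ob_in G.on_ar_in G.src_on_ar
        G.tgt_on_ar G.on_ar_ide G.on_ar_cmp G.on_ar_push G.on_ar_pull)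
qed

section \<open>Formulas and cut-free derivations\<close>

text \<open>
  Names for the objects of a bifibration generated by objects in \<open>'x\<close>: \<open>Push f \<phi>\<close> stands for
  \<open>f\<^sup>+\<phi>\<close> and \<open>Pull g \<phi>\<close> for \<open>g\<^sup>-\<phi>\<close>. Arbitrary arrows \<open>f\<close>, \<open>g\<close> are allowed here; the predicate
  \<open>wf\<close> below selects the meaningful formulas.
\<close>

datatype ('x, 'b) form =
    Atom 'x
  | Push 'b "('x, 'b) form"
  | Pull 'b "('x, 'b) form"

text \<open>A bifibration over \<open>C\<close> with a functor \<open>\<eta>\<close> over \<open>C\<close> from \<open>D\<close>, without any freeness.\<close>

locale bifibration_under =
  p: is_functor D C p + B: bifibration C B + \<eta>: is_functor D "total B" \<eta>
  for D :: "('x, 'd) category" and C :: "('p, 'b) category" and p :: "('x, 'd, 'p, 'b) cat_map"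
    and B :: "('o, 'a, 'p, 'b) bifib" and \<eta> :: "('x, 'd, 'o, 'a) cat_map" +
  assumes proj_unit: "functor_eq D (proj B \<circ>\<^sub>F \<eta>) p"
begin

abbreviation comp (infixl \<open>\<star>\<close> 70) where "\<alpha> \<star> \<beta> \<equiv> \<alpha> \<cdot>\<^bsub>total B\<^esub> \<beta>"

text \<open>The object of \<open>B\<close> that a formula names.\<close>

primrec den :: "('x, 'b) form \<Rightarrow> 'o" where
  "den (Atom X) = on_ob \<eta> X"
| "den (Push f \<phi>) = tgt (total B) (push B f (den \<phi>))"
| "den (Pull g \<phi>) = src (total B) (pull B g (den \<phi>))"

text \<open>Every connective is applied to an object over the appropriate end of its arrow.\<close>

primrec wf :: "('x, 'b) form \<Rightarrow> bool" where
  "wf (Atom X) \<longleftrightarrow> X \<in> Ob D"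
| "wf (Push f \<phi>) \<longleftrightarrow> wf \<phi> \<and> f \<in> Ar C \<and> on_ob (proj B) (den \<phi>) = src C f"
| "wf (Pull g \<phi>) \<longleftrightarrow> wf \<phi> \<and> g \<in> Ar C \<and> on_ob (proj B) (den \<phi>) = tgt C g"

text \<open>
  \<open>der \<phi> \<alpha> \<psi>\<close>: the arrow \<open>\<alpha>\<close> of \<open>B\<close> from \<open>den \<phi>\<close> to \<open>den \<psi>\<close> has a cut-free derivation. The
  formulas are arguments since distinct formulas may name the same object of \<open>B\<close>. The factorizing
  rules \<open>pushL\<close> and \<open>pullR\<close> are stated for a given \<open>\<beta>\<close> whose composite with the lifting is
  derivable, which avoids choosing \<open>\<beta>\<close> from the composite.
\<close>

inductive der :: "('x, 'b) form \<Rightarrow> 'a \<Rightarrow> ('x, 'b) form \<Rightarrow> bool" where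
  ax: "\<delta> \<in> Ar D \<Longrightarrow> der (Atom (src D \<delta>)) (on_ar \<eta> \<delta>) (Atom (tgt D \<delta>))"
| pushL: "\<lbrakk>wf (Push f \<phi>); \<beta> \<in> Ar (total B); src (total B) \<beta> = den (Push f \<phi>);
    der \<phi> (push B f (den \<phi>) \<star> \<beta>) \<psi>\<rbrakk> \<Longrightarrow> der (Push f \<phi>) \<beta> \<psi>"
| pushR: "\<lbrakk>wf (Push f \<psi>); der \<phi> \<alpha> \<psi>\<rbrakk> \<Longrightarrow> der \<phi> (\<alpha> \<star> push B f (den \<psi>)) (Push f \<psi>)"
| pullL: "\<lbrakk>wf (Pull g \<phi>); der \<phi> \<alpha> \<psi>\<rbrakk> \<Longrightarrow> der (Pull g \<phi>) (pull B g (den \<phi>) \<star> \<alpha>) \<psi>"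
| pullR: "\<lbrakk>wf (Pull g \<psi>); \<beta> \<in> Ar (total B); tgt (total B) \<beta> = den (Pull g \<psi>);
    der \<phi> (\<beta> \<star> pull B g (den \<psi>)) \<psi>\<rbrakk> \<Longrightarrow> der \<phi> \<beta> (Pull g \<psi>)"

lemma den_in_Ob: "wf \<phi> \<Longrightarrow> den \<phi> \<in> Ob (total B)"
  by (induction \<phi>)
    (auto simp: \<eta>.on_ob_in intro!: B.D.src_in_Ob B.D.tgt_in_Ob dest: B.push_lift B.pull_lift)

lemma push_den:
  assumes "wf (Push f \<phi>)"
  shows "push B f (den \<phi>) \<in> Ar (total B)" "src (total B) (push B f (den \<phi>)) = den \<phi>"
    "on_ar (proj B) (push B f (den \<phi>)) = f"
  using assms B.push_lift[of f "den \<phi>"] den_in_Ob[of \<phi>] by auto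

lemma pull_den:
  assumes "wf (Pull g \<phi>)"
  shows "pull B g (den \<phi>) \<in> Ar (total B)" "tgt (total B) (pull B g (den \<phi>)) = den \<phi>"
    "on_ar (proj B) (pull B g (den \<phi>)) = g"
  using assms B.pull_lift[of g "den \<phi>"] den_in_Ob[of \<phi>] by auto

lemmas B_simps = B.D.cmp_in_Ar B.D.src_cmp B.D.tgt_cmp

lemma der_typed:
  assumes "der \<phi> \<alpha> \<psi>"
  shows "wf \<phi> \<and> wf \<psi> \<and> \<alpha> \<in> Ar (total B) \<and> src (total B) \<alpha> = den \<phi> \<and> tgt (total B) \<alpha> = den \<psi>"
  using assms
proof induction
  case (ax \<delta>)
  then show ?case
    by (simp add: p.D.src_in_Ob p.D.tgt_in_Ob \<eta>.on_ar_in \<eta>.src_on_ar \<eta>.tgt_on_ar)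
next
  case (pushL f \<phi> \<beta> \<psi>)
  then show ?case using push_den[of f \<phi>] by (simp add: B_simps)
next
  case (pushR f \<psi> \<phi> \<alpha>)
  then show ?case using push_den[of f \<psi>] by (simp add: B_simps)
next
  case (pullL g \<phi> \<alpha> \<psi>)
  then show ?case using pull_den[of g \<phi>] by (simp add: B_simps)
next
  case (pullR g \<psi> \<beta> \<phi>)
  then show ?case using pull_den[of g \<psi>] by (simp add: B_simps)
qed

lemma der_ide: "wf \<phi> \<Longrightarrow> der \<phi> (ide (total B) (den \<phi>)) \<phi>"
proof (induction \<phi>)
  case (Atom X)
  then show ?case
    using ax[of "ide D X"] by (simp add: p.D.ide_in_Ar p.D.src_ide p.D.tgt_ide \<eta>.on_ar_ide)
next
  case (Push f \<phi>)
  note l = push_den[OF Push.prems]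
  have "der \<phi> (ide (total B) (den \<phi>) \<star> push B f (den \<phi>)) (Push f \<phi>)"
    using Push by (intro pushR) auto
  then have "der \<phi> (push B f (den \<phi>) \<star> ide (total B) (den (Push f \<phi>))) (Push f \<phi>)"
    using B.D.ide_cmp[OF l(1)] B.D.cmp_ide[OF l(1)] l(2) by simp
  then show ?case
    using Push.prems den_in_Ob[OF Push.prems]
    by (intro pushL) (auto simp: B.D.ide_in_Ar B.D.src_ide)
next
  case (Pull g \<phi>)
  note l = pull_den[OF Pull.prems]
  have "der (Pull g \<phi>) (pull B g (den \<phi>) \<star> ide (total B) (den \<phi>)) \<phi>"
    using Pull by (intro pullL) auto
  then have "der (Pull g \<phi>) (ide (total B) (den (Pull g \<phi>)) \<star> pull B g (den \<phi>)) \<phi>"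
    using B.D.ide_cmp[OF l(1)] B.D.cmp_ide[OF l(1)] l(2) by simp
  then show ?case
    using Pull.prems den_in_Ob[OF Pull.prems]
    by (intro pullR) (auto simp: B.D.ide_in_Ar B.D.tgt_ide)
qed

lemma der_push: "wf (Push f \<phi>) \<Longrightarrow> der \<phi> (push B f (den \<phi>)) (Push f \<phi>)"
  using pushR[OF _ der_ide, of f \<phi>] push_den[of f \<phi>] B.D.ide_cmp[of "push B f (den \<phi>)"] by simp

lemma der_pull: "wf (Pull g \<phi>) \<Longrightarrow> der (Pull g \<phi>) (pull B g (den \<phi>)) \<phi>"
  using pullL[OF _ der_ide, of g \<phi>] pull_den[of g \<phi>] B.D.cmp_ide[of "pull B g (den \<phi>)"] by simp

text \<open>
  Cut elimination. A left rule at the end of the derivation of \<open>\<alpha>\<close>, or a right rule at the end of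
  that of \<open>\<beta>\<close>, commutes with the cut. Otherwise both derivations end with axioms, or with the right
  and the left rule for the same connective of \<open>\<psi>\<close>, and the cut moves to the smaller formula under it.
\<close>

lemma der_cut:
  assumes "der \<phi> \<alpha> \<psi>" and "der \<psi> \<beta> \<chi>"
  shows "der \<phi> (\<alpha> \<star> \<beta>) \<chi>"
  using assms
proof (induction "size \<phi> + size \<psi> + size \<chi>" arbitrary: \<phi> \<alpha> \<psi> \<beta> \<chi> rule: less_induct)
  case less
  note IH = less.hyps and \<alpha> = less.prems(1) and \<beta> = less.prems(2)
  note ty = der_typed[OF \<alpha>] der_typed[OF \<beta>]
  have pushL_cut: ?case
    if \<phi>: "\<phi> = Push f \<phi>'" and w: "wf (Push f \<phi>')"
      and d: "der \<phi>' (push B f (den \<phi>') \<star> \<alpha>) \<psi>" for f \<phi>'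
  proof -
    have "der \<phi>' ((push B f (den \<phi>') \<star> \<alpha>) \<star> \<beta>) \<chi>"
      by (rule IH[OF _ d \<beta>]) (simp add: \<phi>)
    then show ?thesis
      unfolding \<phi> using \<phi> w ty push_den[OF w]
      by (intro pushL) (auto simp: B_simps B.D.cmp_assoc)
  qed
  have pullL_cut: ?case
    if \<phi>: "\<phi> = Pull g \<phi>'" "\<alpha> = pull B g (den \<phi>') \<star> \<alpha>'" and w: "wf (Pull g \<phi>')"
      and d: "der \<phi>' \<alpha>' \<psi>" for g \<phi>' \<alpha>'
  proof -
    have "der \<phi>' (\<alpha>' \<star> \<beta>) \<chi>"
      by (rule IH[OF _ d \<beta>]) (simp add: \<phi>)
    then have "der (Pull g \<phi>') (pull B g (den \<phi>') \<star> (\<alpha>' \<star> \<beta>)) \<chi>"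
      by (rule pullL[OF w])
    then show ?thesis
      using \<phi> ty pull_den[OF w] der_typed[OF d] by (simp add: B.D.cmp_assoc)
  qed
  show ?case
    using \<beta>
  proof cases
    case (pushR f \<chi>' \<beta>')
    have "der \<phi> (\<alpha> \<star> \<beta>') \<chi>'"
      by (rule IH[OF _ \<alpha> pushR(4)]) (simp add: pushR(2))
    then have "der \<phi> ((\<alpha> \<star> \<beta>') \<star> push B f (den \<chi>')) (Push f \<chi>')"
      by (rule der.pushR[OF pushR(3)])
    then show ?thesis
      using pushR ty push_den[OF pushR(3)] der_typed[OF pushR(4)] by (simp add: B.D.cmp_assoc)
  next
    case (pullR g \<chi>')
    have "der \<phi> (\<alpha> \<star> (\<beta> \<star> pull B g (den \<chi>'))) \<chi>'"
      by (rule IH[OF _ \<alpha> pullR(5)]) (simp add: pullR(1))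
    then show ?thesis
      unfolding pullR(1) using pullR ty pull_den[OF pullR(2)]
      by (intro der.pullR) (auto simp: B_simps B.D.cmp_assoc)
  next
    case \<beta>: (ax \<delta>')
    show ?thesis
      using \<alpha>
    proof cases
      case (ax \<delta>)
      with \<beta> show ?thesis
        using der.ax[of "\<delta> \<cdot>\<^bsub>D\<^esub> \<delta>'"]
        by (simp add: p.D.cmp_in_Ar p.D.src_cmp p.D.tgt_cmp \<eta>.on_ar_cmp)
    next
      case pushL
      from pushL(1,2,5) show ?thesis by (rule pushL_cut)
    next
      case pullL
      then show ?thesis by (rule pullL_cut)
    qed (use \<beta> in auto)
  next
    case \<beta>': (pushL f \<psi>')
    show ?thesis
      using \<alpha>
    proof cases
      case (pushR f' \<psi>'' \<alpha>')
      then have eq: "f' = f" "\<psi>'' = \<psi>'"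
        using \<beta>'(1) by auto
      have "der \<phi> (\<alpha>' \<star> (push B f (den \<psi>') \<star> \<beta>)) \<chi>"
        by (rule IH[OF _ pushR(4)[unfolded eq] \<beta>'(5)]) (simp add: \<beta>'(1))
      then show ?thesis
        using pushR eq ty push_den[OF \<beta>'(2)] der_typed[OF pushR(4)] by (simp add: B.D.cmp_assoc)
    next
      case pushL
      from pushL(1,2,5) show ?thesis by (rule pushL_cut)
    next
      case pullL
      then show ?thesis by (rule pullL_cut)
    qed (use \<beta>' in auto)
  next
    case \<beta>': (pullL g \<psi>' \<beta>')
    show ?thesis
      using \<alpha>
    proof cases
      case (pullR g' \<psi>'')
      then have eq: "g' = g" "\<psi>'' = \<psi>'"
        using \<beta>'(1) by auto
      have "der \<phi> ((\<alpha> \<star> pull B g (den \<psi>')) \<star> \<beta>') \<chi>"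
        by (rule IH[OF _ pullR(5)[unfolded eq] \<beta>'(4)]) (simp add: \<beta>'(1))
      then show ?thesis
        using \<beta>' ty pull_den[OF \<beta>'(3)] der_typed[OF \<beta>'(4)] by (simp add: B.D.cmp_assoc)
    next
      case pushL
      from pushL(1,2,5) show ?thesis by (rule pushL_cut)
    next
      case pullL
      then show ?thesis by (rule pullL_cut)
    qed (use \<beta>' in auto)
  qed
qed

lemma proj_on_ar_unit: "\<delta> \<in> Ar D \<Longrightarrow> on_ar (proj B) (on_ar \<eta> \<delta>) = on_ar p \<delta>"
  using proj_unit by (simp add: functor_eq_def functor_comp_def)

lemma proj_typed:
  assumes "der \<phi> \<alpha> \<psi>"
  shows "on_ar (proj B) \<alpha> \<in> homset C (on_ob (proj B) (den \<phi>)) (on_ob (proj B) (den \<psi>))"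
  using der_typed[OF assms] B.on_ar_in[of \<alpha>] B.src_on_ar[of \<alpha>] B.tgt_on_ar[of \<alpha>]
  by (auto simp: homset_def)

lemma proj_den_push:
  assumes "wf (Push f \<phi>)" shows "on_ob (proj B) (den (Push f \<phi>)) = tgt C f"
  using B.tgt_on_ar[OF push_den(1)[OF assms]] push_den[OF assms] by simp

lemma proj_den_pull:
  assumes "wf (Pull g \<phi>)" shows "on_ob (proj B) (den (Pull g \<phi>)) = src C g"
  using B.src_on_ar[OF pull_den(1)[OF assms]] pull_den[OF assms] by simp

text \<open>
  Among parallel arrows over the same arrow of \<open>C\<close>, a chosen lifting \<open>push\<close> can be cancelled on
  the left and a chosen lifting \<open>pull\<close> on the right. Hence the arrow in the conclusion of a
  factorizing rule is determined by the premise and its image in \<open>C\<close>.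
\<close>

lemma push_cancel:
  assumes w: "wf (Push f \<phi>)"
    and "\<beta> \<in> homset (total B) (den (Push f \<phi>)) T" "\<gamma> \<in> homset (total B) (den (Push f \<phi>)) T"
    and "on_ar (proj B) \<beta> = on_ar (proj B) \<gamma>"
    and "push B f (den \<phi>) \<star> \<beta> = push B f (den \<phi>) \<star> \<gamma>"
  shows "\<beta> = \<gamma>"
proof -
  have "\<exists>!\<beta>'. \<beta>' \<in> homset (total B) (tgt (total B) (push B f (den \<phi>)))
        (tgt (total B) (push B f (den \<phi>) \<star> \<beta>)) \<and>
      on_ar (proj B) \<beta>' = on_ar (proj B) \<beta> \<and> push B f (den \<phi>) \<star> \<beta> = push B f (den \<phi>) \<star> \<beta>'"
    using assms push_den[OF w] proj_den_push[OF w] den_in_Ob[of \<phi>]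
    by (intro B.push_factor) (auto simp: homset_def B_simps B.on_ar_in B.src_on_ar B.on_ar_cmp)
  then have "\<exists>!\<beta>'. \<beta>' \<in> homset (total B) (den (Push f \<phi>)) T \<and>
      on_ar (proj B) \<beta>' = on_ar (proj B) \<beta> \<and> push B f (den \<phi>) \<star> \<beta> = push B f (den \<phi>) \<star> \<beta>'"
    using assms push_den[OF w] by (simp add: homset_def B_simps)
  then show ?thesis
    using assms(2-5) by metis
qed

lemma pull_cancel:
  assumes w: "wf (Pull g \<psi>)"
    and "\<beta> \<in> homset (total B) S (den (Pull g \<psi>))" "\<gamma> \<in> homset (total B) S (den (Pull g \<psi>))"
    and "on_ar (proj B) \<beta> = on_ar (proj B) \<gamma>"
    and "\<beta> \<star> pull B g (den \<psi>) = \<gamma> \<star> pull B g (den \<psi>)"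
  shows "\<beta> = \<gamma>"
proof -
  have "\<exists>!\<beta>'. \<beta>' \<in> homset (total B) (src (total B) (\<beta> \<star> pull B g (den \<psi>)))
        (src (total B) (pull B g (den \<psi>))) \<and>
      on_ar (proj B) \<beta>' = on_ar (proj B) \<beta> \<and> \<beta> \<star> pull B g (den \<psi>) = \<beta>' \<star> pull B g (den \<psi>)"
    using assms pull_den[OF w] proj_den_pull[OF w] den_in_Ob[of \<psi>]
    by (intro B.pull_factor) (auto simp: homset_def B_simps B.on_ar_in B.tgt_on_ar B.on_ar_cmp)
  then have "\<exists>!\<beta>'. \<beta>' \<in> homset (total B) S (den (Pull g \<psi>)) \<and>
      on_ar (proj B) \<beta>' = on_ar (proj B) \<beta> \<and> \<beta> \<star> pull B g (den \<psi>) = \<beta>' \<star> pull B g (den \<psi>)"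
    using assms pull_den[OF w] by (simp add: homset_def B_simps)
  then show ?thesis
    using assms(2-5) by metis
qed

section \<open>Finiteness of proof search\<close>

text \<open>
  The five sets in the proof collect the arrows whose derivation ends with each of the five rules.
\<close>

lemma finite_der:
  assumes D: "relatively_locally_finite C D p"
    and sl: "locally_finite_slices C" and cosl: "locally_finite_coslices C"
  shows "finite {\<alpha>. der \<phi> \<alpha> \<psi> \<and> on_ar (proj B) \<alpha> = h}"
proof (induction "size \<phi> + size \<psi>" arbitrary: \<phi> \<psi> h rule: less_induct)
  case less
  let ?S = "{\<alpha>. der \<phi> \<alpha> \<psi> \<and> on_ar (proj B) \<alpha> = h}"
  define ax where "ax = {\<alpha>. \<exists>X Y \<delta>. \<phi> = Atom X \<and> \<psi> = Atom Y \<and> \<delta> \<in> homset D X Y \<and>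
    on_ar p \<delta> = h \<and> \<alpha> = on_ar \<eta> \<delta>}"
  define pushL where "pushL = {\<beta>. \<exists>f \<phi>'. \<phi> = Push f \<phi>' \<and> wf \<phi> \<and> wf \<psi> \<and>
    \<beta> \<in> homset (total B) (den \<phi>) (den \<psi>) \<and> on_ar (proj B) \<beta> = h \<and>
    der \<phi>' (push B f (den \<phi>') \<star> \<beta>) \<psi>}"
  define pushR where "pushR = {\<alpha> \<star> push B f (den \<psi>') | f \<psi>' \<alpha>. \<psi> = Push f \<psi>' \<and> wf \<psi> \<and>
    der \<phi> \<alpha> \<psi>' \<and> on_ar (proj B) \<alpha> \<cdot>\<^bsub>C\<^esub> f = h}"
  define pullL where "pullL = {pull B g (den \<phi>') \<star> \<alpha> | g \<phi>' \<alpha>. \<phi> = Pull g \<phi>' \<and> wf \<phi> \<and>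
    der \<phi>' \<alpha> \<psi> \<and> g \<cdot>\<^bsub>C\<^esub> on_ar (proj B) \<alpha> = h}"
  define pullR where "pullR = {\<beta>. \<exists>g \<psi>'. \<psi> = Pull g \<psi>' \<and> wf \<phi> \<and> wf \<psi> \<and>
    \<beta> \<in> homset (total B) (den \<phi>) (den \<psi>) \<and> on_ar (proj B) \<beta> = h \<and>
    der \<phi> (\<beta> \<star> pull B g (den \<psi>')) \<psi>'}"
  have "?S \<subseteq> ax \<union> pushL \<union> pullR \<union> pushR \<union> pullL"
  proof
    fix \<alpha> assume "\<alpha> \<in> ?S"
    then have \<alpha>: "der \<phi> \<alpha> \<psi>" and h: "on_ar (proj B) \<alpha> = h"
      by auto
    show "\<alpha> \<in> ax \<union> pushL \<union> pullR \<union> pushR \<union> pullL"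
      using \<alpha>
    proof cases
      case (ax \<delta>)
      then have "\<alpha> \<in> ax"
        using h by (auto simp: ax_def homset_def proj_on_ar_unit)
      then show ?thesis by blast
    next
      case (pushL f \<phi>')
      then have "\<alpha> \<in> pushL"
        using h der_typed[OF \<alpha>] by (auto simp: pushL_def homset_def)
      then show ?thesis by blast
    next
      case (pushR f \<psi>' \<alpha>')
      then have "on_ar (proj B) \<alpha>' \<cdot>\<^bsub>C\<^esub> f = h"
        using h der_typed[OF pushR(4)] push_den[OF pushR(3)] by (simp add: B.on_ar_cmp)
      then have "\<alpha> \<in> pushR"
        using pushR by (auto simp: pushR_def)
      then show ?thesis by blast
    next
      case (pullL g \<phi>' \<alpha>')
      then have "g \<cdot>\<^bsub>C\<^esub> on_ar (proj B) \<alpha>' = h"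
        using h der_typed[OF pullL(4)] pull_den[OF pullL(3)] by (simp add: B.on_ar_cmp)
      then have "\<alpha> \<in> pullL"
        using pullL by (auto simp: pullL_def)
      then show ?thesis by blast
    next
      case (pullR g \<psi>')
      then have "\<alpha> \<in> pullR"
        using h der_typed[OF \<alpha>] by (auto simp: pullR_def homset_def)
      then show ?thesis by blast
    qed
  qed
  moreover have "finite ax"
  proof (cases "\<exists>X Y \<delta>. \<phi> = Atom X \<and> \<psi> = Atom Y \<and> \<delta> \<in> homset D X Y \<and> on_ar p \<delta> = h")
    case True
    then obtain X Y \<delta> where *: "\<phi> = Atom X" "\<psi> = Atom Y" "\<delta> \<in> homset D X Y" "on_ar p \<delta> = h"
      by auto
    then have "finite {\<delta> \<in> homset D X Y. on_ar p \<delta> = h}"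
      using D p.on_ar_in[of \<delta>] p.src_on_ar[of \<delta>] p.tgt_on_ar[of \<delta>] p.D.src_in_Ob[of \<delta>]
        p.D.tgt_in_Ob[of \<delta>]
      unfolding relatively_locally_finite_def homset_def by auto
    moreover have "ax = on_ar \<eta> ` {\<delta> \<in> homset D X Y. on_ar p \<delta> = h}"
      using * by (auto simp: ax_def)
    ultimately show ?thesis by simp
  next
    case False
    then have "ax = {}" by (auto simp: ax_def)
    then show ?thesis by simp
  qed
  moreover have "finite pushL"
  proof (cases "\<exists>f \<phi>'. \<phi> = Push f \<phi>' \<and> wf \<phi>")
    case True
    then obtain f \<phi>' where \<phi>: "\<phi> = Push f \<phi>'" "wf \<phi>"
      by auto
    note w = \<phi>(2)[unfolded \<phi>(1)]
    let ?k = "\<lambda>\<beta>. push B f (den \<phi>') \<star> \<beta>"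
    have "?k ` pushL \<subseteq> {\<alpha>. der \<phi>' \<alpha> \<psi> \<and> on_ar (proj B) \<alpha> = f \<cdot>\<^bsub>C\<^esub> h}"
      using \<phi> push_den[OF w] by (auto simp: pushL_def homset_def B.on_ar_cmp)
    moreover have "finite {\<alpha>. der \<phi>' \<alpha> \<psi> \<and> on_ar (proj B) \<alpha> = f \<cdot>\<^bsub>C\<^esub> h}"
      by (rule less) (simp add: \<phi>)
    moreover have "inj_on ?k pushL"
      by (rule inj_onI, rule push_cancel[OF w, where T = "den \<psi>"]) (auto simp: pushL_def \<phi>)
    ultimately show ?thesis
      by (meson finite_imageD finite_subset)
  next
    case False
    then have "pushL = {}" by (auto simp: pushL_def)
    then show ?thesis by simp
  qed
  moreover have "finite pullR"
  proof (cases "\<exists>g \<psi>'. \<psi> = Pull g \<psi>' \<and> wf \<psi>")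
    case True
    then obtain g \<psi>' where \<psi>: "\<psi> = Pull g \<psi>'" "wf \<psi>"
      by auto
    note w = \<psi>(2)[unfolded \<psi>(1)]
    let ?k = "\<lambda>\<beta>. \<beta> \<star> pull B g (den \<psi>')"
    have "?k ` pullR \<subseteq> {\<alpha>. der \<phi> \<alpha> \<psi>' \<and> on_ar (proj B) \<alpha> = h \<cdot>\<^bsub>C\<^esub> g}"
      using \<psi> pull_den[OF w] by (auto simp: pullR_def homset_def B.on_ar_cmp)
    moreover have "finite {\<alpha>. der \<phi> \<alpha> \<psi>' \<and> on_ar (proj B) \<alpha> = h \<cdot>\<^bsub>C\<^esub> g}"
      by (rule less) (simp add: \<psi>)
    moreover have "inj_on ?k pullR"
      by (rule inj_onI, rule pull_cancel[OF w, where S = "den \<phi>"]) (auto simp: pullR_def \<psi>)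
    ultimately show ?thesis
      by (meson finite_imageD finite_subset)
  next
    case False
    then have "pullR = {}" by (auto simp: pullR_def)
    then show ?thesis by simp
  qed
  moreover have "finite pushR"
    \<comment> \<open>The premise lies over one of finitely many left factors of \<open>h\<close>.\<close>
  proof (cases "pushR = {}")
    case False
    then obtain f \<psi>' \<alpha> where \<psi>: "\<psi> = Push f \<psi>'" "wf (Push f \<psi>')"
      and \<alpha>: "der \<phi> \<alpha> \<psi>'" "on_ar (proj B) \<alpha> \<cdot>\<^bsub>C\<^esub> f = h"
      by (auto simp: pushR_def)
    let ?K = "{k \<in> homset C (src C h) (src C f). k \<cdot>\<^bsub>C\<^esub> f = h}"
    have h: "h \<in> Ar C" "tgt C f = tgt C h" "f \<in> Ar C"
      and src_h: "src C h = on_ob (proj B) (den \<phi>)"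
      using \<alpha> \<psi> proj_typed[OF \<alpha>(1)]
      by (auto simp: homset_def p.C.cmp_in_Ar p.C.tgt_cmp p.C.src_cmp)
    have "pushR \<subseteq> (\<lambda>\<alpha>. \<alpha> \<star> push B f (den \<psi>')) `
        (\<Union>k\<in>?K. {\<alpha>. der \<phi> \<alpha> \<psi>' \<and> on_ar (proj B) \<alpha> = k})"
    proof
      fix \<beta> assume "\<beta> \<in> pushR"
      then obtain \<alpha>' where "\<beta> = \<alpha>' \<star> push B f (den \<psi>')" "der \<phi> \<alpha>' \<psi>'"
        "on_ar (proj B) \<alpha>' \<cdot>\<^bsub>C\<^esub> f = h"
        using \<psi> by (auto simp: pushR_def)
      then show "\<beta> \<in> (\<lambda>\<alpha>. \<alpha> \<star> push B f (den \<psi>')) `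
          (\<Union>k\<in>?K. {\<alpha>. der \<phi> \<alpha> \<psi>' \<and> on_ar (proj B) \<alpha> = k})"
        using \<psi> proj_typed[of \<phi> \<alpha>' \<psi>'] by (auto simp: src_h)
    qed
    moreover have "finite ?K"
      by (rule finite_left_factors[OF p.C.category_axioms sl h(3,1,2)])
    moreover have "finite {\<alpha>. der \<phi> \<alpha> \<psi>' \<and> on_ar (proj B) \<alpha> = k}" for k
      by (rule less) (simp add: \<psi>)
    ultimately show ?thesis
      by (meson finite_UN_I finite_imageI finite_subset)
  qed simp
  moreover have "finite pullL"
    \<comment> \<open>The premise lies over one of finitely many right factors of \<open>h\<close>.\<close>
  proof (cases "pullL = {}")
    case False
    then obtain g \<phi>' \<alpha> where \<phi>: "\<phi> = Pull g \<phi>'" "wf (Pull g \<phi>')"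
      and \<alpha>: "der \<phi>' \<alpha> \<psi>" "g \<cdot>\<^bsub>C\<^esub> on_ar (proj B) \<alpha> = h"
      by (auto simp: pullL_def)
    let ?K = "{k \<in> homset C (tgt C g) (tgt C h). g \<cdot>\<^bsub>C\<^esub> k = h}"
    have h: "h \<in> Ar C" "src C g = src C h" "g \<in> Ar C"
      and tgt_h: "tgt C h = on_ob (proj B) (den \<psi>)"
      using \<alpha> \<phi> proj_typed[OF \<alpha>(1)]
      by (auto simp: homset_def p.C.cmp_in_Ar p.C.tgt_cmp p.C.src_cmp)
    have "pullL \<subseteq> (\<lambda>\<alpha>. pull B g (den \<phi>') \<star> \<alpha>) `
        (\<Union>k\<in>?K. {\<alpha>. der \<phi>' \<alpha> \<psi> \<and> on_ar (proj B) \<alpha> = k})"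
    proof
      fix \<beta> assume "\<beta> \<in> pullL"
      then obtain \<alpha>' where "\<beta> = pull B g (den \<phi>') \<star> \<alpha>'" "der \<phi>' \<alpha>' \<psi>"
        "g \<cdot>\<^bsub>C\<^esub> on_ar (proj B) \<alpha>' = h"
        using \<phi> by (auto simp: pullL_def)
      then show "\<beta> \<in> (\<lambda>\<alpha>. pull B g (den \<phi>') \<star> \<alpha>) `
          (\<Union>k\<in>?K. {\<alpha>. der \<phi>' \<alpha> \<psi> \<and> on_ar (proj B) \<alpha> = k})"
        using \<phi> proj_typed[of \<phi>' \<alpha>' \<psi>] by (auto simp: tgt_h)
    qed
    moreover have "finite ?K"
      by (rule finite_right_factors[OF p.C.category_axioms cosl h(3,1,2)])
    moreover have "finite {\<alpha>. der \<phi>' \<alpha> \<psi> \<and> on_ar (proj B) \<alpha> = k}" for k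
      by (rule less) (simp add: \<phi>)
    ultimately show ?thesis
      by (meson finite_UN_I finite_imageI finite_subset)
  qed simp
  ultimately show ?case
    by (rule finite_subset[OF _ finite_UnI[OF finite_UnI[OF finite_UnI[OF finite_UnI]]]])
qed

end

section \<open>The bifibration of derivable arrows\<close>

lemma ex1_image:
  assumes "\<exists>!x. P x" and "\<And>y. Q y \<longleftrightarrow> (\<exists>x. P x \<and> y = c x)"
  shows "\<exists>!y. Q y"
  using assms by metis

text \<open>
  A free bifibration is tested only against bifibrations with objects and arrows in one fixed type,
  so formulas and derivable arrows are represented by codes. A derivable arrow is coded together
  with its two formulas, since these are not determined by it.
\<close>

locale coded_bifibration_under = bifibration_under D C p B \<eta>
  for D :: "('x, 'd) category" and C :: "('p, 'b) category" and p :: "('x, 'd, 'p, 'b) cat_map"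
    and B :: "('o, 'a, 'p, 'b) bifib" and \<eta> :: "('x, 'd, 'o, 'a) cat_map" +
  fixes ob_code :: "('x, 'b) form \<Rightarrow> 'v"
    and ar_code :: "('x, 'b) form \<times> 'a \<times> ('x, 'b) form \<Rightarrow> 'w"
  assumes inj_ob_code: "inj ob_code" and inj_ar_code: "inj ar_code"
begin

definition ob_decode :: "'v \<Rightarrow> ('x, 'b) form" where
  "ob_decode = inv ob_code"

definition ar_decode :: "'w \<Rightarrow> ('x, 'b) form \<times> 'a \<times> ('x, 'b) form" where
  "ar_decode = inv ar_code"

lemma ob_decode_code [simp]: "ob_decode (ob_code \<phi>) = \<phi>"
  by (simp add: ob_decode_def inj_ob_code)

lemma ar_decode_code [simp]: "ar_decode (ar_code t) = t"
  by (simp add: ar_decode_def inj_ar_code)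

lemma code_eq_iff [simp]:
  "ob_code \<phi> = ob_code \<psi> \<longleftrightarrow> \<phi> = \<psi>" "ar_code t = ar_code u \<longleftrightarrow> t = u"
  using inj_ob_code inj_ar_code by (auto dest: injD)

text \<open>The category of well-formed formulas and derivable arrows.\<close>

definition der_cat :: "('v, 'w) category" where
  "der_cat =
    \<lparr> Ob = {ob_code \<phi> | \<phi>. wf \<phi>},
      Ar = {ar_code (\<phi>, \<alpha>, \<psi>) | \<phi> \<alpha> \<psi>. der \<phi> \<alpha> \<psi>},
      src = (\<lambda>a. case ar_decode a of (\<phi>, \<alpha>, \<psi>) \<Rightarrow> ob_code \<phi>),
      tgt = (\<lambda>a. case ar_decode a of (\<phi>, \<alpha>, \<psi>) \<Rightarrow> ob_code \<psi>),
      ide = (\<lambda>x. ar_code (ob_decode x, ide (total B) (den (ob_decode x)), ob_decode x)),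
      cmp = (\<lambda>a b. case (ar_decode a, ar_decode b) of ((\<phi>, \<alpha>, \<psi>), (\<psi>', \<beta>, \<chi>)) \<Rightarrow>
        ar_code (\<phi>, \<alpha> \<star> \<beta>, \<chi>)) \<rparr>"

text \<open>The functor to \<open>B\<close> that replaces a formula by the object it names.\<close>

definition forget :: "('v, 'w, 'o, 'a) cat_map" where
  "forget = \<lparr> on_ob = den \<circ> ob_decode, on_ar = (\<lambda>a. case ar_decode a of (\<phi>, \<alpha>, \<psi>) \<Rightarrow> \<alpha>) \<rparr>"

text \<open>
  The chosen liftings of \<open>\<phi>\<close> are those of \<open>den \<phi>\<close> in \<open>B\<close>, with \<open>Push f \<phi>\<close> and \<open>Pull g \<phi>\<close> at
  their other ends.
\<close>

definition der_bifib :: "('v, 'w, 'p, 'b) bifib" where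
  "der_bifib =
    \<lparr> total = der_cat,
      proj = proj B \<circ>\<^sub>F forget,
      push = (\<lambda>f x. let \<phi> = ob_decode x in ar_code (\<phi>, push B f (den \<phi>), Push f \<phi>)),
      pull = (\<lambda>g x. let \<phi> = ob_decode x in ar_code (Pull g \<phi>, pull B g (den \<phi>), \<phi>)) \<rparr>"

text \<open>The lifting of \<open>\<eta>\<close> through \<open>forget\<close>, by atoms and axioms.\<close>

definition atoms :: "('x, 'd, 'v, 'w) cat_map" where
  "atoms =
    \<lparr> on_ob = (\<lambda>X. ob_code (Atom X)),
      on_ar = (\<lambda>\<delta>. ar_code (Atom (src D \<delta>), on_ar \<eta> \<delta>, Atom (tgt D \<delta>))) \<rparr>"

lemma der_cat_sel [simp]:
  "ob_code \<phi> \<in> Ob der_cat \<longleftrightarrow> wf \<phi>"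
  "ar_code (\<phi>, \<alpha>, \<psi>) \<in> Ar der_cat \<longleftrightarrow> der \<phi> \<alpha> \<psi>"
  "src der_cat (ar_code (\<phi>, \<alpha>, \<psi>)) = ob_code \<phi>"
  "tgt der_cat (ar_code (\<phi>, \<alpha>, \<psi>)) = ob_code \<psi>"
  "ide der_cat (ob_code \<phi>) = ar_code (\<phi>, ide (total B) (den \<phi>), \<phi>)"
  "ar_code (\<phi>, \<alpha>, \<psi>) \<cdot>\<^bsub>der_cat\<^esub> ar_code (\<psi>', \<beta>, \<chi>) = ar_code (\<phi>, \<alpha> \<star> \<beta>, \<chi>)"
  by (auto simp: der_cat_def)

lemma forget_sel [simp]:
  "on_ob forget (ob_code \<phi>) = den \<phi>" "on_ar forget (ar_code (\<phi>, \<alpha>, \<psi>)) = \<alpha>"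
  by (auto simp: forget_def)

lemma der_bifib_sel [simp]:
  "total der_bifib = der_cat"
  "on_ob (proj der_bifib) x = on_ob (proj B) (on_ob forget x)"
  "on_ar (proj der_bifib) a = on_ar (proj B) (on_ar forget a)"
  "push der_bifib f (ob_code \<phi>) = ar_code (\<phi>, push B f (den \<phi>), Push f \<phi>)"
  "pull der_bifib g (ob_code \<phi>) = ar_code (Pull g \<phi>, pull B g (den \<phi>), \<phi>)"
  by (auto simp: der_bifib_def functor_comp_def)

lemma der_cat_ObE:
  assumes "x \<in> Ob der_cat" obtains \<phi> where "x = ob_code \<phi>" "wf \<phi>"
  using assms by (auto simp: der_cat_def)

lemma der_cat_ArE:
  assumes "a \<in> Ar der_cat" obtains \<phi> \<alpha> \<psi> where "a = ar_code (\<phi>, \<alpha>, \<psi>)" "der \<phi> \<alpha> \<psi>"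
  using assms by (auto simp: der_cat_def)

lemma category_der_cat: "category der_cat"
proof
  fix f g h
  assume "f \<in> Ar der_cat" "g \<in> Ar der_cat" "h \<in> Ar der_cat"
    "tgt der_cat f = src der_cat g" "tgt der_cat g = src der_cat h"
  then show "f \<cdot>\<^bsub>der_cat\<^esub> g \<cdot>\<^bsub>der_cat\<^esub> h = f \<cdot>\<^bsub>der_cat\<^esub> (g \<cdot>\<^bsub>der_cat\<^esub> h)"
    by (auto elim!: der_cat_ArE dest!: der_typed simp: B.D.cmp_assoc)
next
  fix f assume "f \<in> Ar der_cat"
  then obtain \<phi> \<alpha> \<psi> where f: "f = ar_code (\<phi>, \<alpha>, \<psi>)" "der \<phi> \<alpha> \<psi>"
    by (rule der_cat_ArE)
  show "ide der_cat (src der_cat f) \<cdot>\<^bsub>der_cat\<^esub> f = f" "f \<cdot>\<^bsub>der_cat\<^esub> ide der_cat (tgt der_cat f) = f"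
    using der_typed[OF f(2)] B.D.ide_cmp[of \<alpha>] B.D.cmp_ide[of \<alpha>] by (auto simp: f(1))
qed (auto elim!: der_cat_ArE der_cat_ObE intro: der_ide der_cut dest: der_typed)

lemma functor_forget: "is_functor der_cat (total B) forget"
  by (intro is_functor.intro is_functor_axioms.intro category_der_cat B.D.category_axioms)
    (auto elim!: der_cat_ArE der_cat_ObE dest: der_typed intro: den_in_Ob)

lemma functor_proj_der: "is_functor der_cat C (proj der_bifib)"
  using functor_forget unfolding is_functor_def is_functor_axioms_def
  by (simp add: p.C.category_axioms B.on_ob_in B.on_ar_in B.src_on_ar B.tgt_on_ar B.on_ar_ide
      B.on_ar_cmp)

text \<open>
  Factorizations through the liftings in \<open>B\<close> of derivable arrows are again derivable; this is what
  the rules \<open>pushL\<close> and \<open>pullR\<close> say.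
\<close>

lemma push_factor_der:
  assumes w: "wf (Push f \<phi>)" and g: "g \<in> Ar C" "tgt C f = src C g"
    and d: "der \<phi> \<alpha> \<psi>" and pr: "on_ar (proj B) \<alpha> = f \<cdot>\<^bsub>C\<^esub> g"
  shows "\<exists>!\<beta>. der (Push f \<phi>) \<beta> \<psi> \<and> on_ar (proj B) \<beta> = g \<and> \<alpha> = push B f (den \<phi>) \<star> \<beta>"
proof -
  have "\<exists>!\<beta>. \<beta> \<in> homset (total B) (tgt (total B) (push B f (den \<phi>))) (tgt (total B) \<alpha>) \<and>
      on_ar (proj B) \<beta> = g \<and> \<alpha> = push B f (den \<phi>) \<star> \<beta>"
    using assms der_typed[OF d] den_in_Ob[of \<phi>] by (intro B.push_factor) auto
  moreover have "der (Push f \<phi>) \<beta> \<psi> \<longleftrightarrow>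
      \<beta> \<in> homset (total B) (tgt (total B) (push B f (den \<phi>))) (tgt (total B) \<alpha>)"
    if "\<alpha> = push B f (den \<phi>) \<star> \<beta>" for \<beta>
    using that d der_typed[OF d] w by (auto simp: homset_def dest: der_typed intro: pushL)
  ultimately show ?thesis
    by metis
qed

lemma pull_factor_der:
  assumes w: "wf (Pull g \<psi>)" and f: "f \<in> Ar C" "tgt C f = src C g"
    and d: "der \<phi> \<alpha> \<psi>" and pr: "on_ar (proj B) \<alpha> = f \<cdot>\<^bsub>C\<^esub> g"
  shows "\<exists>!\<beta>. der \<phi> \<beta> (Pull g \<psi>) \<and> on_ar (proj B) \<beta> = f \<and> \<alpha> = \<beta> \<star> pull B g (den \<psi>)"
proof -
  have "\<exists>!\<beta>. \<beta> \<in> homset (total B) (src (total B) \<alpha>) (src (total B) (pull B g (den \<psi>))) \<and>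
      on_ar (proj B) \<beta> = f \<and> \<alpha> = \<beta> \<star> pull B g (den \<psi>)"
    using assms der_typed[OF d] den_in_Ob[of \<psi>] by (intro B.pull_factor) auto
  moreover have "der \<phi> \<beta> (Pull g \<psi>) \<longleftrightarrow>
      \<beta> \<in> homset (total B) (src (total B) \<alpha>) (src (total B) (pull B g (den \<psi>)))"
    if "\<alpha> = \<beta> \<star> pull B g (den \<psi>)" for \<beta>
    using that d der_typed[OF d] w by (auto simp: homset_def dest: der_typed intro: pullR)
  ultimately show ?thesis
    by metis
qed

lemma homset_der_cat:
  "homset der_cat (ob_code \<phi>) (ob_code \<psi>) = (\<lambda>\<alpha>. ar_code (\<phi>, \<alpha>, \<psi>)) ` {\<alpha>. der \<phi> \<alpha> \<psi>}"
  by (auto simp: homset_def elim!: der_cat_ArE)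

lemma bifibration_der: "bifibration C der_bifib"
proof (intro bifibration.intro bifibration_axioms.intro)
  show "is_functor (total der_bifib) C (proj der_bifib)"
    using functor_proj_der by simp
next
  fix f S
  assume "f \<in> Ar C" "S \<in> Ob (total der_bifib)" "on_ob (proj der_bifib) S = src C f"
  then show "push der_bifib f S \<in> Ar (total der_bifib) \<and>
      src (total der_bifib) (push der_bifib f S) = S \<and>
      on_ar (proj der_bifib) (push der_bifib f S) = f"
    by (auto elim!: der_cat_ObE intro!: der_push simp: push_den)
next
  fix g T
  assume "g \<in> Ar C" "T \<in> Ob (total der_bifib)" "on_ob (proj der_bifib) T = tgt C g"
  then show "pull der_bifib g T \<in> Ar (total der_bifib) \<and>
      tgt (total der_bifib) (pull der_bifib g T) = T \<and>
      on_ar (proj der_bifib) (pull der_bifib g T) = g"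
    by (auto elim!: der_cat_ObE intro!: der_pull simp: pull_den)
next
  fix f S g a
  assume f: "f \<in> Ar C" and S: "S \<in> Ob (total der_bifib)" "on_ob (proj der_bifib) S = src C f"
    and g: "g \<in> Ar C" "tgt C f = src C g"
    and a: "a \<in> Ar (total der_bifib)" "src (total der_bifib) a = S"
      "on_ar (proj der_bifib) a = f \<cdot>\<^bsub>C\<^esub> g"
  from a(1) obtain \<phi> \<alpha> \<psi> where \<alpha>: "a = ar_code (\<phi>, \<alpha>, \<psi>)" "der \<phi> \<alpha> \<psi>"
    by (auto elim: der_cat_ArE)
  then have S': "S = ob_code \<phi>"
    using a by simp
  have "\<exists>!\<beta>. der (Push f \<phi>) \<beta> \<psi> \<and> on_ar (proj B) \<beta> = g \<and> \<alpha> = push B f (den \<phi>) \<star> \<beta>"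
    using f S S' g a \<alpha> by (intro push_factor_der) auto
  then show "\<exists>!b. b \<in> homset (total der_bifib) (tgt (total der_bifib) (push der_bifib f S))
        (tgt (total der_bifib) a) \<and>
      on_ar (proj der_bifib) b = g \<and> a = push der_bifib f S \<cdot>\<^bsub>total der_bifib\<^esub> b"
    by (rule ex1_image[where c = "\<lambda>\<beta>. ar_code (Push f \<phi>, \<beta>, \<psi>)"])
      (auto simp: S' \<alpha>(1) homset_der_cat)
next
  fix g T f a
  assume g: "g \<in> Ar C" and T: "T \<in> Ob (total der_bifib)" "on_ob (proj der_bifib) T = tgt C g"
    and f: "f \<in> Ar C" "tgt C f = src C g"
    and a: "a \<in> Ar (total der_bifib)" "tgt (total der_bifib) a = T"
      "on_ar (proj der_bifib) a = f \<cdot>\<^bsub>C\<^esub> g"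
  from a(1) obtain \<phi> \<alpha> \<psi> where \<alpha>: "a = ar_code (\<phi>, \<alpha>, \<psi>)" "der \<phi> \<alpha> \<psi>"
    by (auto elim: der_cat_ArE)
  then have T': "T = ob_code \<psi>"
    using a by simp
  have "\<exists>!\<beta>. der \<phi> \<beta> (Pull g \<psi>) \<and> on_ar (proj B) \<beta> = f \<and> \<alpha> = \<beta> \<star> pull B g (den \<psi>)"
    using g T T' f a \<alpha> by (intro pull_factor_der) auto
  then show "\<exists>!b. b \<in> homset (total der_bifib) (src (total der_bifib) a)
        (src (total der_bifib) (pull der_bifib g T)) \<and>
      on_ar (proj der_bifib) b = f \<and> a = b \<cdot>\<^bsub>total der_bifib\<^esub> pull der_bifib g T"
    by (rule ex1_image[where c = "\<lambda>\<beta>. ar_code (\<phi>, \<beta>, Pull g \<psi>)"])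
      (auto simp: T' \<alpha>(1) homset_der_cat)
qed

lemma bifibration_morphism_forget: "bifibration_morphism C der_bifib B forget"
  by (intro bifibration_morphism.intro bifibration_morphism_axioms.intro bifibration_der
      B.bifibration_axioms)
    (use functor_forget in \<open>auto simp: functor_eq_def functor_comp_def elim!: der_cat_ObE\<close>)

lemma functor_atoms: "is_functor D der_cat atoms"
  by (intro is_functor.intro is_functor_axioms.intro category_der_cat p.D.category_axioms)
    (auto simp: atoms_def p.D.src_in_Ob p.D.tgt_in_Ob p.D.src_ide p.D.tgt_ide p.D.src_cmp
      p.D.tgt_cmp \<eta>.on_ar_ide \<eta>.on_ar_cmp intro: ax)

lemma forget_atoms: "functor_eq D (forget \<circ>\<^sub>F atoms) \<eta>"
  by (simp add: functor_eq_def functor_comp_def atoms_def)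

lemma proj_atoms: "functor_eq D (proj der_bifib \<circ>\<^sub>F atoms) p"
  using proj_unit by (simp add: functor_eq_def functor_comp_def atoms_def)

end

section \<open>Codes in an infinite type\<close>

lemma inj_pairing: "\<exists>e :: 'u::infinite \<times> 'u \<Rightarrow> 'u. inj e"
proof -
  have "infinite (UNIV :: 'u set)"
    by (rule infinite_UNIV)
  from card_of_Times_same_infinite[OF this] show ?thesis
    by (auto simp: card_of_ordIso[symmetric] bij_betw_def)
qed

lemma inj_form_code: "\<exists>c :: ('u::infinite, 'u) form \<Rightarrow> 'u. inj c"
proof -
  obtain e :: "'u \<times> 'u \<Rightarrow> 'u" where e: "inj e"
    using inj_pairing by auto
  obtain t :: "nat \<Rightarrow> 'u" where t: "inj t"
    using infinite_countable_subset[OF infinite_UNIV] by auto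
  define c :: "('u, 'u) form \<Rightarrow> 'u" where
    "c = rec_form (\<lambda>X. e (t 0, X)) (\<lambda>f _ x. e (t 1, e (f, x))) (\<lambda>g _ x. e (t 2, e (g, x)))"
  have c: "c (Atom X) = e (t 0, X)" "c (Push f \<phi>) = e (t 1, e (f, c \<phi>))"
    "c (Pull f \<phi>) = e (t 2, e (f, c \<phi>))" for X f \<phi>
    by (simp_all add: c_def)
  have iff: "e x = e y \<longleftrightarrow> x = y" "t i = t j \<longleftrightarrow> i = j" for x y i j
    using e t by (auto dest: injD)
  have "c \<phi> = c \<psi> \<Longrightarrow> \<phi> = \<psi>" for \<phi> \<psi>
  proof (induction \<phi> arbitrary: \<psi>)
    case (Atom X)
    then show ?case by (cases \<psi>) (auto simp: c iff)
  next
    case (Push f \<phi>)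
    then show ?case by (cases \<psi>) (auto simp: c iff)
  next
    case (Pull g \<phi>)
    then show ?case by (cases \<psi>) (auto simp: c iff)
  qed
  then have "inj c"
    by (rule injI)
  then show ?thesis by (rule exI[of inj])
qed

lemma inj_arrow_code:
  "\<exists>k :: ('u::infinite, 'u) form \<times> 'u \<times> ('u, 'u) form \<Rightarrow> 'u. inj k"
proof -
  obtain e :: "'u \<times> 'u \<Rightarrow> 'u" where e: "inj e"
    using inj_pairing by auto
  obtain c :: "('u, 'u) form \<Rightarrow> 'u" where c: "inj c"
    using inj_form_code by auto
  have "inj (\<lambda>(\<phi>, \<alpha>, \<psi>). e (c \<phi>, e (\<alpha>, c \<psi>)))"
    by (auto intro!: injI simp: inj_eq[OF e] inj_eq[OF c])
  then show ?thesis by (rule exI[of inj])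
qed

section \<open>Relative local finiteness of the free bifibration\<close>

lemma (in free_bifibration) bifibration_under_unit: "bifibration_under D C p B \<eta>"
  by unfold_locales (rule proj_unit)

text \<open>
  The formulas \<open>\<Phi> S\<close> are the images of the objects \<open>S\<close> under the morphism that universality gives
  from \<open>B\<close> to the bifibration of derivable arrows, a section of \<open>forget\<close>. What matters is that they do not
  depend on \<open>\<alpha>\<close>.
\<close>

lemma (in free_bifibration) ex_derivation:
  "\<exists>\<Phi>. \<forall>\<alpha>\<in>Ar (total B).
    bifibration_under.der D C B \<eta> (\<Phi> (src (total B) \<alpha>)) \<alpha> (\<Phi> (tgt (total B) \<alpha>))"
proof -
  obtain c :: "('u, 'u) form \<Rightarrow> 'u" where c: "inj c"
    using inj_form_code by auto
  obtain k :: "('u, 'u) form \<times> 'u \<times> ('u, 'u) form \<Rightarrow> 'u" where k: "inj k"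
    using inj_arrow_code by auto
  interpret E: coded_bifibration_under D C p B \<eta> c k
    by (intro coded_bifibration_under.intro coded_bifibration_under_axioms.intro
        bifibration_under_unit c k)
  obtain F where F: "bifibration_morphism C B E.der_bifib F" "functor_eq D (F \<circ>\<^sub>F \<eta>) E.atoms"
    using universal_ex[OF E.bifibration_der _ E.proj_atoms] E.functor_atoms by auto
  interpret F: bifibration_morphism C B E.der_bifib F by fact
  have "functor_eq (total B) (E.forget \<circ>\<^sub>F F) \<lparr>on_ob = id, on_ar = id\<rparr>"
  proof (rule universal_uniq[OF B.bifibration_axioms \<eta>.is_functor_axioms proj_unit])
    show "bifibration_morphism C B B (E.forget \<circ>\<^sub>F F)"
      by (rule bifibration_morphism_comp[OF F(1) E.bifibration_morphism_forget])
    show "functor_eq D (E.forget \<circ>\<^sub>F F \<circ>\<^sub>F \<eta>) \<eta>"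
      using F(2) E.forget_atoms by (simp add: functor_eq_def functor_comp_def)
    show "bifibration_morphism C B B \<lparr>on_ob = id, on_ar = id\<rparr>"
      by (rule bifibration_morphism_id[OF B.bifibration_axioms])
    show "functor_eq D (\<lparr>on_ob = id, on_ar = id\<rparr> \<circ>\<^sub>F \<eta>) \<eta>"
      by (simp add: functor_eq_def functor_comp_def)
  qed
  then have id: "on_ar E.forget (on_ar F \<alpha>) = \<alpha>" if "\<alpha> \<in> Ar (total B)" for \<alpha>
    using that by (simp add: functor_eq_def functor_comp_def)
  have "E.der (E.ob_decode (on_ob F (src (total B) \<alpha>))) \<alpha> (E.ob_decode (on_ob F (tgt (total B) \<alpha>)))"
    if \<alpha>: "\<alpha> \<in> Ar (total B)" for \<alpha>
  proof -
    obtain \<phi> \<beta> \<psi> where \<beta>: "on_ar F \<alpha> = k (\<phi>, \<beta>, \<psi>)" "E.der \<phi> \<beta> \<psi>"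
      using F.on_ar_in[OF \<alpha>] by (auto elim: E.der_cat_ArE)
    then show ?thesis
      using id[OF \<alpha>] F.src_on_ar[OF \<alpha>, symmetric] F.tgt_on_ar[OF \<alpha>, symmetric] by simp
  qed
  then show ?thesis
    by (intro exI[of _ "\<lambda>X. E.ob_decode (on_ob F X)"]) auto
qed

theorem theorem3p30:
  fixes D C :: "('u::infinite, 'u) category"
    and p :: "('u, 'u, 'u, 'u) cat_map"
    and B :: "('u, 'u, 'u, 'u) bifib"
    and \<eta> :: "('u, 'u, 'u, 'u) cat_map"
  assumes "category D" and "category C" and "is_functor D C p"
    and "factorization_preordered C"
    and "relatively_locally_finite C D p"
    and "locally_finite_slices C" and "locally_finite_coslices C"
    and "free_bifibration D C p B \<eta>"
  shows "relatively_locally_finite C (total B) (proj B) \<and>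
    (\<forall>A\<in>Ob C. locally_finite (fiber C (total B) (proj B) A))"
proof -
  interpret free_bifibration D C p B \<eta> by fact
  interpret G: bifibration_under D C p B \<eta>
    by (rule bifibration_under_unit)
  obtain \<Phi> where \<Phi>: "G.der (\<Phi> (src (total B) \<alpha>)) \<alpha> (\<Phi> (tgt (total B) \<alpha>))"
    if "\<alpha> \<in> Ar (total B)" for \<alpha>
    using ex_derivation by auto
  have fin: "finite {\<alpha> \<in> homset (total B) X Y. on_ar (proj B) \<alpha> = h}" for X Y h
  proof (rule finite_subset)
    show "{\<alpha> \<in> homset (total B) X Y. on_ar (proj B) \<alpha> = h}
        \<subseteq> {\<alpha>. G.der (\<Phi> X) \<alpha> (\<Phi> Y) \<and> on_ar (proj B) \<alpha> = h}"
      using \<Phi> by (auto simp: homset_def)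
    show "finite {\<alpha>. G.der (\<Phi> X) \<alpha> (\<Phi> Y) \<and> on_ar (proj B) \<alpha> = h}"
      by (rule G.finite_der) fact+
  qed
  moreover have "homset (fiber C (total B) (proj B) A) X Y =
      {\<alpha> \<in> homset (total B) X Y. on_ar (proj B) \<alpha> = ide C A}" for A X Y
    by (auto simp: homset_def fiber_def)
  ultimately show ?thesis
    by (simp add: relatively_locally_finite_def locally_finite_def)
qed

end
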